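(* In the fully synchronous model ($\mathcal{FSYNC}$), Algorithm KnownNNoChirality (defined in the context) allows two anonymous agents without chirality to explore a 1-interval connected ring and to explicitly terminate in time $3N-6$, where $N$ is a known upper bound on the ring size.
   Context: Ring: the nodes $v_0,\dots,v_{n-1}$ (indices modulo $n$) form a cycle; $v_i$ is linked to $v_{i-1}$ and $v_{i+1}$ via distinctly labelled ports $q_{i-}$ and $q_{i+}$ (labels need not be globally consistent). Time proceeds in rounds; in each round at most one edge, chosen by an adversary, is missing (1-interval connected ring). Nodes are anonymous (no distinguishable identifiers). The agents know $N\ge n$. Agents: each has memory and computational power; they are anonymous (no identifiers) and all execute the same protocol. They start at arbitrary, not necessarily distinct, nodes, cannot communicate explicitly and cannot mark nodes. Each agent $a_j$ has a consistent private orientation, i.e. a function $\lambda_j$ designating each port left or right with $\lambda_j(q_{i-})=\lambda_j(q_{k-})$ for all $i,k$. Without chirality, the orientations of different agents need not agree. Round: each active agent performs Look (it sees its own position within its node, i.e. whether it is on a port and which one, and the positions of the other agents at that node), Compute (from this snapshot and its memory it determines a direction in $\{left,right,nil\}$; if $nil$ it becomes inactive; otherwise it tries to access the corresponding port if not already there), and Move. Ports are accessed in mutual exclusion: an occupied port cannot be gained, and if several agents try the same port exactly one succeeds; an agent that fails sets $moved=false$ and becomes inactive. An agent on a port after computing moves to the other endpoint if the edge is present in this round (setting $moved=true$), and otherwise stays on the port (setting $moved=false$); in either case the port is denied to other agents in that round. Two agents crossing the same edge in opposite directions in the same round might not detect each other. $\mathcal{FSYNC}$: all agents are active in every round. Exploration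 is solved if within finite time every node is visited by at least one agent. It is with explicit termination if every agent, within finite time, enters a terminal state and no longer moves; a terminal state may be entered only after the ring has been explored. Procedure Explore($dir$ | $p_1:s_1$; ...; $p_k:s_k$), with $dir\in\{left,right\}$ (in the agent's own orientation), predicates $p_i$ and states $s_i$: the agent performs Look, then evaluates $p_1,\dots,p_k$ in order; as soon as some $p_i$ is satisfied the procedure exits and the agent makes a transition to state $s_i$. If no predicate is satisfied, the agent tries to move in direction $dir$ and the procedure is executed again in the next round. Variables and predicates of an agent: $Ttime$ is the number of rounds since the beginning of the execution; $Btime$ is the number of consecutive rounds the agent has currently been waiting in a port. "catches": the agent observes the other agent on the port corresponding to its own moving direction. "caught": the agent is on a port after a failed move and the other agent is observed in the node. "failed": the agent tried to enter a port and failed to do so. Algorithm KnownNNoChirality (each agent starts in state Init): - State Init: Explore(left | ($Ttime\ge 2N-4$ and $Btime=N-1$) or failed: Bounce; catches: Bounce; caught: Forward; $Ttime\ge 2N-4$: Forward). - State Bounce: Explore(right | $Ttime\ge 3N-6$: Terminate). - State Forward: Explore(left | $Ttime\ge 3N-6$: Terminate). Terminate is the terminal state.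
   Formalization: In state Init the test Btime = N-1 is replaced by Btime ≥ N-1: with equality, for N > 3, two agents facing each other across an always-missing edge both go Forward and terminate without exploring. The ring is taken to have n ≥ 3 nodes. *)

theory Defs
  imports "HOL-Library.Multiset"
begin

section \<open>Agents on a dynamic ring\<close>

text \<open>The ring has nodes \<open>0, \<dots>, n - 1\<close>. Side \<open>Plus\<close> of node \<open>i\<close> is the port towards
  \<open>i + 1\<close>, side \<open>Minus\<close> the port towards \<open>i - 1\<close> (modulo \<open>n\<close>). Agents never see sides or
  node numbers: they see ports only through their private orientation, a bijection from sides to
  directions. Using one bijection for all nodes makes the orientation consistent; different
  agents may have different bijections (no chirality).\<close>

datatype side = Minus | Plus

datatype direction = Left | Right

type_synonym orientation = "side \<Rightarrow> direction"

datatype 'p place = Inside | Port 'p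

fun neighbour :: "nat \<Rightarrow> nat \<Rightarrow> side \<Rightarrow> nat" where
  "neighbour n i Plus = (i + 1) mod n"
| "neighbour n i Minus = (i + n - 1) mod n"

text \<open>Edge \<open>i\<close> joins node \<open>i\<close> to node \<open>(i + 1) mod n\<close>.\<close>

fun edge :: "nat \<Rightarrow> nat \<Rightarrow> side \<Rightarrow> nat" where
  "edge n i Plus = i"
| "edge n i Minus = (i + n - 1) mod n"

text \<open>\<open>Ttime\<close> counts the completed rounds; \<open>Btime\<close> counts the consecutive rounds, up to the last
  completed one, at whose end the agent was still on a port. The flags \<open>moved\<close> and \<open>failed\<close>
  describe the last completed round: \<open>failed\<close> means that the agent tried to enter a port and did
  not gain it, as opposed to being on a port whose edge was missing.\<close>

record 'q memory =
  ctrl :: 'q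
  Ttime :: nat
  Btime :: nat
  moved :: bool
  failed :: bool

record 'q agent =
  node :: nat
  pos :: "side place"
  mem :: "'q memory"

record view =
  own :: "direction place"
  others :: "direction place multiset"

text \<open>A protocol gets neither an identifier nor a node name. It returns the new control state
  and the direction of the attempted move, \<open>None\<close> being nil.\<close>

type_synonym 'q protocol = "'q memory \<Rightarrow> view \<Rightarrow> 'q \<times> direction option"

definition look :: "('a::finite \<Rightarrow> orientation) \<Rightarrow> ('a \<Rightarrow> 'q agent) \<Rightarrow> 'a \<Rightarrow> view" where
  "look ori C a =
    \<lparr> own = map_place (ori a) (pos (C a)),
      others = image_mset (\<lambda>b. map_place (ori a) (pos (C b)))
                 (mset_set {b. b \<noteq> a \<and> node (C b) = node (C a)}) \<rparr>"

definition decision ::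
  "'q protocol \<Rightarrow> ('a::finite \<Rightarrow> orientation) \<Rightarrow> ('a \<Rightarrow> 'q agent) \<Rightarrow> 'a \<Rightarrow> 'q \<times> direction option" where
  "decision P ori C a = P (mem (C a)) (look ori C a)"

definition occupied :: "('a \<Rightarrow> 'q agent) \<Rightarrow> nat \<Rightarrow> side \<Rightarrow> bool" where
  "occupied C i s \<longleftrightarrow> (\<exists>b. node (C b) = i \<and> pos (C b) = Port s)"

definition contenders ::
  "'q protocol \<Rightarrow> ('a::finite \<Rightarrow> orientation) \<Rightarrow> ('a \<Rightarrow> 'q agent) \<Rightarrow> nat \<Rightarrow> side \<Rightarrow> 'a set" where
  "contenders P ori C i s =
    {a. node (C a) = i \<and> snd (decision P ori C a) = Some (ori a s) \<and> pos (C a) \<noteq> Port s}"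

text \<open>\<open>G\<close> is the set of agents that gain the port they try to access in this round.\<close>

definition mutual_exclusion ::
  "'q protocol \<Rightarrow> ('a::finite \<Rightarrow> orientation) \<Rightarrow> ('a \<Rightarrow> 'q agent) \<Rightarrow> 'a set \<Rightarrow> bool" where
  "mutual_exclusion P ori C G \<longleftrightarrow>
    (\<forall>i s. if occupied C i s then contenders P ori C i s \<inter> G = {}
           else contenders P ori C i s \<noteq> {} \<longrightarrow> (\<exists>!a. a \<in> contenders P ori C i s \<inter> G))"

text \<open>One synchronous round, with \<open>e\<close> the missing edge, if any.
  An agent that does not gain the port it tries to access stays where it was.\<close>

definition next_agent ::
  "nat \<Rightarrow> 'q protocol \<Rightarrow> ('a::finite \<Rightarrow> orientation) \<Rightarrow> nat option \<Rightarrow> 'a set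
    \<Rightarrow> ('a \<Rightarrow> 'q agent) \<Rightarrow> 'a \<Rightarrow> 'q agent" where
  "next_agent n P ori e G C a =
    (let i = node (C a); p = pos (C a); m = mem (C a);
         q = fst (decision P ori C a);
         wait = (if p = Inside then 0 else Suc (Btime m))
     in case snd (decision P ori C a) of
          None \<Rightarrow>
            \<lparr> node = i, pos = p,
              mem = \<lparr> ctrl = q, Ttime = Suc (Ttime m), Btime = wait,
                      moved = moved m, failed = False \<rparr> \<rparr>
        | Some d \<Rightarrow>
            (let s = inv (ori a) d in
             if p \<noteq> Port s \<and> a \<notin> G then
               \<lparr> node = i, pos = p,
                 mem = \<lparr> ctrl = q, Ttime = Suc (Ttime m), Btime = wait,
                         moved = False, failed = True \<rparr> \<rparr>
             else if e = Some (edge n i s) then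
               \<lparr> node = i, pos = Port s,
                 mem = \<lparr> ctrl = q, Ttime = Suc (Ttime m), Btime = Suc (Btime m),
                         moved = False, failed = False \<rparr> \<rparr>
             else
               \<lparr> node = neighbour n i s, pos = Inside,
                 mem = \<lparr> ctrl = q, Ttime = Suc (Ttime m), Btime = 0,
                         moved = True, failed = False \<rparr> \<rparr>))"

text \<open>\<open>C t\<close> is the configuration after \<open>t\<close> rounds. The missing edge and the winners of contested
  ports are chosen adversarially in every round. The initial value of \<open>moved\<close> has no
  significance: the flag only matters for an agent on a port.\<close>

definition execution ::
  "nat \<Rightarrow> 'q protocol \<Rightarrow> 'q \<Rightarrow> ('a::finite \<Rightarrow> orientation) \<Rightarrow> (nat \<Rightarrow> 'a \<Rightarrow> 'q agent) \<Rightarrow> bool" where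
  "execution n P q0 ori C \<longleftrightarrow>
    (\<forall>a. node (C 0 a) < n \<and> pos (C 0 a) = Inside \<and>
         mem (C 0 a) = \<lparr> ctrl = q0, Ttime = 0, Btime = 0, moved = False, failed = False \<rparr>) \<and>
    (\<forall>t. \<exists>e G. mutual_exclusion P ori (C t) G \<and>
               (\<forall>a. C (Suc t) a = next_agent n P ori e G (C t) a))"

definition explored_by :: "nat \<Rightarrow> (nat \<Rightarrow> 'a \<Rightarrow> 'q agent) \<Rightarrow> nat \<Rightarrow> bool" where
  "explored_by n C T \<longleftrightarrow> (\<forall>i<n. \<exists>t\<le>T. \<exists>a. node (C t a) = i)"

text \<open>\<open>terminal_at P qT ori C a t\<close>: agent \<open>a\<close> is in the terminal state \<open>qT\<close> after the Compute
  phase that follows the first \<open>t\<close> rounds.\<close>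

definition terminal_at ::
  "'q protocol \<Rightarrow> 'q \<Rightarrow> ('a::finite \<Rightarrow> orientation) \<Rightarrow> (nat \<Rightarrow> 'a \<Rightarrow> 'q agent) \<Rightarrow> 'a \<Rightarrow> nat \<Rightarrow> bool" where
  "terminal_at P qT ori C a t \<longleftrightarrow> fst (decision P ori (C t) a) = qT"

definition explores_and_terminates_by ::
  "nat \<Rightarrow> 'q protocol \<Rightarrow> 'q \<Rightarrow> ('a::finite \<Rightarrow> orientation) \<Rightarrow> (nat \<Rightarrow> 'a \<Rightarrow> 'q agent) \<Rightarrow> nat \<Rightarrow> bool" where
  "explores_and_terminates_by n P qT ori C T \<longleftrightarrow>
    explored_by n C T \<and>
    (\<forall>a. \<exists>t\<le>T. terminal_at P qT ori C a t) \<and>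
    (\<forall>a t. terminal_at P qT ori C a t \<longrightarrow>
       explored_by n C t \<and>
       (\<forall>t'\<ge>t. terminal_at P qT ori C a t' \<and>
               node (C t' a) = node (C t a) \<and> pos (C t' a) = pos (C t a)))"


section \<open>Algorithm KnownNNoChirality\<close>

definition catches :: "direction \<Rightarrow> view \<Rightarrow> bool" where
  "catches d v \<longleftrightarrow> Port d \<in># others v"

definition caught :: "'q memory \<Rightarrow> view \<Rightarrow> bool" where
  "caught m v \<longleftrightarrow> own v \<noteq> Inside \<and> \<not> moved m \<and> Inside \<in># others v"

text \<open>\<open>explore q d [(p\<^sub>1, r\<^sub>1), \<dots>]\<close> is procedure Explore called in control state \<open>q\<close>;
  \<open>r\<^sub>i\<close> is the outcome of executing the target state of the \<open>i\<close>-th transition. A transition takes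
  no time: the new state is executed in the same round, on the same snapshot.\<close>

fun explore ::
  "'q \<Rightarrow> direction \<Rightarrow> (bool \<times> 'q \<times> direction option) list \<Rightarrow> 'q \<times> direction option" where
  "explore q d [] = (q, Some d)"
| "explore q d ((p, r) # ps) = (if p then r else explore q d ps)"

datatype state = Init | Bounce | Forward | Terminate

definition run_Terminate :: "state \<times> direction option" where
  "run_Terminate = (Terminate, None)"

definition run_Forward :: "nat \<Rightarrow> state memory \<Rightarrow> state \<times> direction option" where
  "run_Forward N m = explore Forward Left [(Ttime m \<ge> 3 * N - 6, run_Terminate)]"

definition run_Bounce :: "nat \<Rightarrow> state memory \<Rightarrow> state \<times> direction option" where
  "run_Bounce N m = explore Bounce Right [(Ttime m \<ge> 3 * N - 6, run_Terminate)]"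

text \<open>The test on \<open>Btime\<close> means that the waiting time has reached the threshold \<open>N - 1\<close>. It is
  only ever relevant when \<open>Ttime = 2 * N - 4\<close>, and by then the agent may have been waiting for
  more than \<open>N - 1\<close> rounds. For \<open>N > 3\<close>, testing for equality would make the algorithm incorrect:
  two agents blocked from the start at the two ends of the same edge would both go to \<open>Forward\<close>.\<close>

definition run_Init :: "nat \<Rightarrow> state memory \<Rightarrow> view \<Rightarrow> state \<times> direction option" where
  "run_Init N m v = explore Init Left
     [((Ttime m \<ge> 2 * N - 4 \<and> Btime m \<ge> N - 1) \<or> failed m, run_Bounce N m),
      (catches Left v, run_Bounce N m),
      (caught m v, run_Forward N m),
      (Ttime m \<ge> 2 * N - 4, run_Forward N m)]"

definition KnownNNoChirality :: "nat \<Rightarrow> state protocol" where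
  "KnownNNoChirality N m v =
    (case ctrl m of
       Init \<Rightarrow> run_Init N m v
     | Bounce \<Rightarrow> run_Bounce N m
     | Forward \<Rightarrow> run_Forward N m
     | Terminate \<Rightarrow> run_Terminate)"

end

theory Submission
  imports Defs
begin

text \<open>Call the agents departing if they move away from each other, the nodes between them (behind
  their backs) being explored. Until everything is explored they never try the same edge, so at
  least one of them advances in every round, and \<open>n - 2\<close> rounds suffice once they are on different
  nodes. So it is enough that they depart, or that all is explored, by round \<open>2 * N - 4\<close>.

  With equal orientations they try different edges as long as neither catches the other. If one
  does, they depart, as the catcher bounces and the caught agent goes forward; otherwise
  \<open>2 * N - 4\<close> steps have been made by then, which is enough to explore. With opposite orientations
  they approach each other, and depart once they have met or crossed. The adversary can prevent
  this only by blocking the edge between them; then in round \<open>2 * N - 4\<close> both have been waiting for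
  at least \<open>N - 1\<close> rounds (unless all is explored), so both bounce and depart.\<close>

section \<open>Sides, edges and unrolled coordinates\<close>

fun opp :: "side \<Rightarrow> side" where
  "opp Plus = Minus"
| "opp Minus = Plus"

fun sgn_side :: "side \<Rightarrow> int" where
  "sgn_side Plus = 1"
| "sgn_side Minus = - 1"

lemma opp_opp [simp]: "opp (opp s) = s"
  by (cases s) auto

lemma opp_neq [simp]: "opp s \<noteq> s" "s \<noteq> opp s"
  by (cases s; simp)+

lemma neq_opp_iff: "s \<noteq> s' \<longleftrightarrow> s = opp s'"
  by (cases s; cases s') auto

lemma sgn_side_opp [simp]: "sgn_side (opp s) = - sgn_side s"
  by (cases s) auto

lemma sgn_side_square [simp]: "sgn_side s * sgn_side s = 1"
  by (cases s) auto

lemma sgn_side_dvd_cancel [simp]: "m dvd sgn_side s * k \<longleftrightarrow> m dvd k"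
  by (cases s) auto

lemma int_neighbour:
  assumes "0 < n"
  shows "int (neighbour n i s) = (int i + sgn_side s) mod int n"
proof (cases s)
  case Plus
  then show ?thesis by (simp add: zmod_int add.commute)
next
  case Minus
  have "int (i + n - 1) = int i - 1 + int n" using assms by simp
  then show ?thesis using Minus by (simp add: zmod_int)
qed

lemma edge_opp:
  assumes "i < n" "j < n"
  shows "edge n j (opp s) = edge n i s \<longleftrightarrow> j = neighbour n i s"
proof (cases s)
  case Plus
  have "(j + n - 1) mod n = i \<longleftrightarrow> j = (i + 1) mod n"
    using assms by (cases "j = 0"; cases "Suc i = n") (auto simp: mod_if)
  then show ?thesis using Plus by simp
next
  case Minus
  then show ?thesis by simp
qed

lemma edge_same:
  assumes "i < n" "j < n"
  shows "edge n i s = edge n j s \<longleftrightarrow> i = j"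
proof (cases s)
  case Minus
  have "(i + n - 1) mod n = (j + n - 1) mod n \<longleftrightarrow> i = j"
    using assms by (cases "i = 0"; cases "j = 0") (auto simp: mod_if)
  then show ?thesis using Minus by simp
qed simp

lemma not_dvd_between: "0 < k \<Longrightarrow> k < m \<Longrightarrow> \<not> m dvd (k :: int)"
  using zdvd_not_zless by blast

text \<open>Coordinates are unrolled along side \<open>s\<close>: moving on side \<open>s\<close> adds \<open>1\<close>, and coordinates
  that agree modulo \<open>n\<close> denote the same node.\<close>

definition located :: "nat \<Rightarrow> side \<Rightarrow> 'q agent \<Rightarrow> int \<Rightarrow> bool" where
  "located n s c k \<longleftrightarrow> int (node c) = (sgn_side s * k) mod int n"

lemma located_exists: "node c < n \<Longrightarrow> located n s c (sgn_side s * int (node c))"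
  by (simp add: located_def flip: mult.assoc)

lemma located_less: "0 < n \<Longrightarrow> located n s c k \<Longrightarrow> node c < n"
  unfolding located_def
  by (metis of_nat_0_less_iff of_nat_less_iff pos_mod_bound)

lemma located_eq_iff:
  assumes "located n s c k" "located n s c' k'"
  shows "node c = node c' \<longleftrightarrow> int n dvd k - k'"
proof -
  have "node c = node c' \<longleftrightarrow> (sgn_side s * k) mod int n = (sgn_side s * k') mod int n"
    using assms by (metis located_def of_nat_eq_iff)
  also have "\<dots> \<longleftrightarrow> int n dvd sgn_side s * (k - k')"
    by (simp add: mod_eq_dvd_iff right_diff_distrib)
  finally show ?thesis by simp
qed

lemma located_neighbour:
  assumes "0 < n" "located n s c k"
  shows "int (neighbour n (node c) s) = (sgn_side s * (k + 1)) mod int n"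
    and "int (neighbour n (node c) (opp s)) = (sgn_side s * (k - 1)) mod int n"
  using assms by (simp_all add: int_neighbour located_def mod_simps algebra_simps)

lemma located_shift: "located n s c (k + int n) \<longleftrightarrow> located n s c k"
proof -
  have "sgn_side s * (k + int n) = sgn_side s * k + sgn_side s * int n"
    by (simp add: algebra_simps)
  then show ?thesis unfolding located_def by simp
qed

text \<open>The outcome of a round for an agent that holds or gains the port on side \<open>s\<close>.\<close>

definition attempt :: "nat \<Rightarrow> nat option \<Rightarrow> 'q agent \<Rightarrow> side \<Rightarrow> 'q \<Rightarrow> 'q agent" where
  "attempt n e c s q =
    (if e = Some (edge n (node c) s)
     then \<lparr> node = node c, pos = Port s,
            mem = \<lparr> ctrl = q, Ttime = Suc (Ttime (mem c)), Btime = Suc (Btime (mem c)),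
                    moved = False, failed = False \<rparr> \<rparr>
     else \<lparr> node = neighbour n (node c) s, pos = Inside,
            mem = \<lparr> ctrl = q, Ttime = Suc (Ttime (mem c)), Btime = 0,
                    moved = True, failed = False \<rparr> \<rparr>)"

lemma attempt_blocked:
  "e = Some (edge n (node c) s) \<Longrightarrow> node (attempt n e c s q) = node c"
  "e = Some (edge n (node c) s) \<Longrightarrow> pos (attempt n e c s q) = Port s"
  "e = Some (edge n (node c) s) \<Longrightarrow> Btime (mem (attempt n e c s q)) = Suc (Btime (mem c))"
  "e = Some (edge n (node c) s) \<Longrightarrow> \<not> moved (mem (attempt n e c s q))"
  by (simp_all add: attempt_def)

lemma attempt_moved:
  "e \<noteq> Some (edge n (node c) s) \<Longrightarrow> node (attempt n e c s q) = neighbour n (node c) s"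
  "e \<noteq> Some (edge n (node c) s) \<Longrightarrow> pos (attempt n e c s q) = Inside"
  "e \<noteq> Some (edge n (node c) s) \<Longrightarrow> Btime (mem (attempt n e c s q)) = 0"
  by (simp_all add: attempt_def)

lemma attempt_mem [simp]:
  "ctrl (mem (attempt n e c s q)) = q"
  "\<not> failed (mem (attempt n e c s q))"
  "Btime (mem (attempt n e c s q)) \<le> Suc (Btime (mem c))"
  by (simp_all add: attempt_def)

lemma located_attempt:
  assumes "0 < n" "located n s c k"
  shows "located n s (attempt n e c s q)
           (if e = Some (edge n (node c) s) then k else k + 1)"
    and "located n s (attempt n e c (opp s) q)
           (if e = Some (edge n (node c) (opp s)) then k else k - 1)"
  using assms located_neighbour[OF assms]
  by (auto simp: located_def attempt_def)

section \<open>Decisions and single rounds of two agents\<close>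

locale two_agents =
  fixes n N :: nat
    and ori :: "'a::finite \<Rightarrow> orientation"
    and C :: "nat \<Rightarrow> 'a \<Rightarrow> state agent"
  assumes n_ge: "n \<ge> 3" and N_ge: "N \<ge> n"
    and card_agents: "card (UNIV :: 'a set) = 2"
    and bij_ori: "\<And>a. bij (ori a)"
    and exec: "execution n (KnownNNoChirality N) Init ori C"
begin

abbreviation dec :: "nat \<Rightarrow> 'a \<Rightarrow> state \<times> direction option" where
  "dec t a \<equiv> decision (KnownNNoChirality N) ori (C t) a"

definition lft :: "'a \<Rightarrow> side" where
  "lft a = inv (ori a) Left"

lemma inv_ori [simp]: "inv (ori a) (ori a s) = s"
  using bij_ori by (simp add: bij_is_inj)

lemma ori_eq_iff [simp]: "ori a s = ori a s' \<longleftrightarrow> s = s'"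
  using bij_ori by (metis inv_ori)

lemma ori_lft [simp]: "ori a (lft a) = Left"
  using bij_ori by (simp add: lft_def bij_is_surj surj_f_inv_f)

lemma ori_opp_lft [simp]: "ori a (opp (lft a)) = Right"
  by (metis direction.exhaust opp_neq(1) ori_eq_iff ori_lft)

lemma ori_eq_Left_iff: "Left = ori a s \<longleftrightarrow> s = lft a"
  by (metis ori_eq_iff ori_lft)

lemma UNIV_agents: "a \<noteq> b \<Longrightarrow> c = a \<or> c = (b :: 'a)"
proof (rule ccontr)
  assume "a \<noteq> b" "\<not> (c = a \<or> c = b)"
  then have "card {a, b, c} = 3" by auto
  moreover have "card {a, b, c} \<le> card (UNIV :: 'a set)" by (intro card_mono) auto
  ultimately show False using card_agents by simp
qed

lemma initial:
  "node (C 0 a) < n" "pos (C 0 a) = Inside" "ctrl (mem (C 0 a)) = Init"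
  "Btime (mem (C 0 a)) = 0" "\<not> failed (mem (C 0 a))" "Ttime (mem (C 0 a)) = 0"
  using exec by (auto simp: execution_def)

lemma one_round:
  obtains e G where "mutual_exclusion (KnownNNoChirality N) ori (C t) G"
    and "\<And>a. C (Suc t) a = next_agent n (KnownNNoChirality N) ori e G (C t) a"
  using exec unfolding execution_def by blast

lemma Ttime_eq [simp]: "Ttime (mem (C t a)) = t"
proof (induction t arbitrary: a)
  case 0
  then show ?case by (simp add: initial)
next
  case (Suc t)
  obtain e G where "\<And>a. C (Suc t) a = next_agent n (KnownNNoChirality N) ori e G (C t) a"
    using one_round[of t] by blast
  then show ?case
    by (simp add: next_agent_def Let_def Suc split: option.split)
qed

lemma look_others:
  assumes "a \<noteq> b"
  shows "others (look ori (C t) a) =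
    (if node (C t b) = node (C t a) then {# map_place (ori a) (pos (C t b)) #} else {#})"
proof -
  have "{c. c \<noteq> a \<and> node (C t c) = node (C t a)} =
    (if node (C t b) = node (C t a) then {b} else {})"
    using assms UNIV_agents[OF assms] by auto
  then show ?thesis by (simp add: look_def)
qed

lemma look_own: "own (look ori (C t) a) = map_place (ori a) (pos (C t a))"
  by (simp add: look_def)

lemma catches_iff:
  assumes "a \<noteq> b"
  shows "catches Left (look ori (C t) a) \<longleftrightarrow>
    node (C t b) = node (C t a) \<and> pos (C t b) = Port (lft a)"
  by (cases "pos (C t b)")
    (auto simp: catches_def look_others[OF assms] ori_eq_Left_iff)

lemma caught_iff:
  assumes "a \<noteq> b"
  shows "caught (mem (C t a)) (look ori (C t) a) \<longleftrightarrow>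
    pos (C t a) \<noteq> Inside \<and> \<not> moved (mem (C t a)) \<and>
    node (C t b) = node (C t a) \<and> pos (C t b) = Inside"
  by (cases "pos (C t b)"; cases "pos (C t a)")
    (auto simp: caught_def look_others[OF assms] look_own)

lemma dec_Forward:
  "ctrl (mem (C t a)) = Forward \<Longrightarrow> t < 3 * N - 6 \<Longrightarrow> dec t a = (Forward, Some Left)"
  by (simp add: decision_def KnownNNoChirality_def run_Forward_def)

lemma dec_Bounce:
  "ctrl (mem (C t a)) = Bounce \<Longrightarrow> t < 3 * N - 6 \<Longrightarrow> dec t a = (Bounce, Some Right)"
  by (simp add: decision_def KnownNNoChirality_def run_Bounce_def)

text \<open>The first two tests both lead to \<open>Bounce\<close> and the last two to
  \<open>Forward\<close>, so the four merge into two.\<close>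

lemma dec_Init:
  assumes "a \<noteq> b" "ctrl (mem (C t a)) = Init" "t < 3 * N - 6"
  shows "dec t a =
    (if t \<ge> 2 * N - 4 \<and> Btime (mem (C t a)) \<ge> N - 1 \<or> failed (mem (C t a)) \<or>
        node (C t b) = node (C t a) \<and> pos (C t b) = Port (lft a)
     then (Bounce, Some Right)
     else if t \<ge> 2 * N - 4 \<or>
        pos (C t a) \<noteq> Inside \<and> \<not> moved (mem (C t a)) \<and>
        node (C t b) = node (C t a) \<and> pos (C t b) = Inside
     then (Forward, Some Left)
     else (Init, Some Left))"
  using assms(2,3)
  by (simp add: decision_def KnownNNoChirality_def run_Init_def run_Bounce_def run_Forward_def
      catches_iff[OF assms(1)] caught_iff[OF assms(1)])

text \<open>In \<open>Init\<close> too: \<open>3 * N - 6\<close> is at least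
  \<open>2 * N - 4\<close>, so some transition fires, and its target is executed in the same
  round.\<close>

lemma dec_late: "t \<ge> 3 * N - 6 \<Longrightarrow> dec t a = (Terminate, None)"
proof -
  assume t: "t \<ge> 3 * N - 6"
  then have "t \<ge> 2 * N - 4" using n_ge N_ge by simp
  with t show ?thesis
    by (cases "ctrl (mem (C t a))")
      (simp_all add: decision_def KnownNNoChirality_def run_Init_def run_Bounce_def
        run_Forward_def run_Terminate_def)
qed

lemma ctrl_Suc: "ctrl (mem (C (Suc t) a)) = fst (dec t a)"
proof -
  obtain e G where "\<And>a. C (Suc t) a = next_agent n (KnownNNoChirality N) ori e G (C t) a"
    using one_round[of t] by blast
  then show ?thesis
    by (simp add: next_agent_def Let_def split: option.split)
qed

lemma early_ctrl: "t \<le> 3 * N - 6 \<Longrightarrow> ctrl (mem (C t a)) \<noteq> Terminate"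
proof (induction t arbitrary: a)
  case (Suc t)
  then have "fst (dec t a) \<noteq> Terminate"
    by (cases "ctrl (mem (C t a))")
      (auto simp: decision_def KnownNNoChirality_def run_Init_def run_Bounce_def run_Forward_def
        run_Terminate_def)
  then show ?case by (simp add: ctrl_Suc)
qed (simp add: initial)

lemma terminal_at_iff:
  "terminal_at (KnownNNoChirality N) Terminate ori C a t \<longleftrightarrow> t \<ge> 3 * N - 6"
proof (cases "t \<ge> 3 * N - 6")
  case True
  then show ?thesis by (simp add: terminal_at_def dec_late)
next
  case False
  then have "ctrl (mem (C (Suc t) a)) \<noteq> Terminate" by (intro early_ctrl) simp
  then show ?thesis using False by (simp add: terminal_at_def ctrl_Suc)
qed

lemma halted:
  assumes "t \<ge> 3 * N - 6" "t' \<ge> t"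
  shows "node (C t' a) = node (C t a) \<and> pos (C t' a) = pos (C t a)"
  using assms(2)
proof (induction t' rule: dec_induct)
  case (step t')
  obtain e G where "\<And>a. C (Suc t') a = next_agent n (KnownNNoChirality N) ori e G (C t') a"
    using one_round[of t'] by blast
  moreover have "dec t' a = (Terminate, None)"
    using dec_late step.hyps assms(1) by simp
  ultimately show ?case using step.IH by (simp add: next_agent_def Let_def)
qed simp

text \<open>Only the other agent could hold or want the port. If it does neither, the port is free
  with a single contender, which mutual exclusion lets through.\<close>

lemma gains:
  assumes "mutual_exclusion (KnownNNoChirality N) ori (C t) G" "a \<noteq> b"
    and "snd (dec t a) = Some (ori a s)"
    and "node (C t b) \<noteq> node (C t a) \<or> pos (C t b) \<noteq> Port s \<and> snd (dec t b) \<noteq> Some (ori b s)"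
  shows "pos (C t a) = Port s \<or> a \<in> G"
proof (cases "pos (C t a) = Port s")
  case False
  let ?K = "contenders (KnownNNoChirality N) ori (C t) (node (C t a)) s"
  have "\<not> (node (C t c) = node (C t a) \<and> pos (C t c) = Port s)" for c
    using UNIV_agents[OF assms(2), of c] assms(4) False by fastforce
  then have free: "\<not> occupied (C t) (node (C t a)) s"
    unfolding occupied_def by blast
  have "c \<in> ?K \<longleftrightarrow> c = a" for c
    using UNIV_agents[OF assms(2), of c] assms(2-4) False by (auto simp: contenders_def)
  then have "?K = {a}" by blast
  then have "\<exists>!c. c \<in> {a} \<inter> G"
    using assms(1) free unfolding mutual_exclusion_def by (metis insert_not_empty)
  then show ?thesis by blast
qed simp

lemma next_attempt:
  assumes "dec t a = (q, Some (ori a s))" "pos (C t a) = Port s \<or> a \<in> G"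
  shows "next_agent n (KnownNNoChirality N) ori e G (C t) a = attempt n e (C t a) s q"
  using assms by (auto simp: next_agent_def attempt_def Let_def)

text \<open>Both outcomes share one \<open>e\<close>, so at least one agent moves whenever the two
  edges differ.\<close>

lemma both_attempt:
  assumes "a \<noteq> b"
    and "dec t a = (qa, Some (ori a sa))" "dec t b = (qb, Some (ori b sb))"
    and "node (C t a) \<noteq> node (C t b) \<or>
         sa \<noteq> sb \<and> pos (C t a) \<noteq> Port sb \<and> pos (C t b) \<noteq> Port sa"
  obtains e where "C (Suc t) a = attempt n e (C t a) sa qa"
    and "C (Suc t) b = attempt n e (C t b) sb qb"
proof -
  obtain e G where G: "mutual_exclusion (KnownNNoChirality N) ori (C t) G"
    and step: "\<And>a. C (Suc t) a = next_agent n (KnownNNoChirality N) ori e G (C t) a"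
    using one_round[of t] by blast
  have "pos (C t a) = Port sa \<or> a \<in> G"
    using assms by (intro gains[OF G assms(1)]) auto
  moreover have "pos (C t b) = Port sb \<or> b \<in> G"
    using assms by (intro gains[OF G assms(1)[symmetric]]) auto
  ultimately show thesis
    using that[of e] step assms(2,3) next_attempt by metis
qed

section \<open>Visited coordinates and exploration\<close>

definition visited :: "side \<Rightarrow> nat \<Rightarrow> int \<Rightarrow> bool" where
  "visited s t k \<longleftrightarrow> (\<exists>t'\<le>t. \<exists>a. located n s (C t' a) k)"

lemma visited_mono: "visited s t k \<Longrightarrow> t \<le> t' \<Longrightarrow> visited s t' k"
  unfolding visited_def by (meson order_trans)

lemma visitedI: "located n s (C t a) k \<Longrightarrow> visited s t k"
  unfolding visited_def by blast

lemma explored_mono: "explored_by n C t \<Longrightarrow> t \<le> t' \<Longrightarrow> explored_by n C t'"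
  unfolding explored_by_def by (meson order_trans)

text \<open>Any \<open>n\<close> consecutive coordinates form a complete residue system;
  \<open>?k\<close> is the representative of node \<open>i\<close> in the window from
  \<open>l\<close>.\<close>

lemma exploredI:
  assumes "\<And>k. l \<le> k \<Longrightarrow> k \<le> l + int n - 1 \<Longrightarrow> visited s t k"
  shows "explored_by n C t"
  unfolding explored_by_def
proof (intro allI impI)
  fix i assume i: "i < n"
  let ?k = "l + (sgn_side s * int i - l) mod int n"
  have "(sgn_side s * int i - l) mod int n < int n"
    "0 \<le> (sgn_side s * int i - l) mod int n"
    using n_ge by simp_all
  then have "visited s t ?k" by (intro assms) linarith+
  then obtain t' a where t': "t' \<le> t" "located n s (C t' a) ?k"
    unfolding visited_def by blast
  have "?k mod int n = (sgn_side s * int i) mod int n"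
    by (simp add: mod_add_right_eq)
  then have "(sgn_side s * ?k) mod int n = (sgn_side s * (sgn_side s * int i)) mod int n"
    by (metis mod_mult_right_eq)
  also have "\<dots> = int i" using i by (simp flip: mult.assoc)
  finally have "node (C t' a) = i"
    using t'(2) unfolding located_def by simp
  then show "\<exists>u\<le>t. \<exists>a. node (C u a) = i"
    using t'(1) by blast
qed

lemma nodes_differ:
  assumes "located n s (C t a) k" "located n s (C t b) k'" "0 < \<bar>k - k'\<bar>" "\<bar>k - k'\<bar> < int n"
  shows "node (C t a) \<noteq> node (C t b)"
  using located_eq_iff[OF assms(1,2)] not_dvd_between[OF assms(3,4)] by simp

lemma facing_iff:
  assumes "located n s (C t a) k" "located n s (C t b) k'"
  shows "edge n (node (C t b)) (opp s) = edge n (node (C t a)) s \<longleftrightarrow> int n dvd k' - (k + 1)"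
proof -
  have n: "0 < n" using n_ge by simp
  \<comment> \<open>A dummy agent on the node next to \<open>a\<close>, so that
    \<open>located_eq_iff\<close> can compare that node with the one of \<open>b\<close>.\<close>
  have "located n s \<lparr> node = neighbour n (node (C t a)) s, pos = Inside, mem = undefined \<rparr> (k + 1)"
    using located_neighbour(1)[OF n assms(1)] by (simp add: located_def)
  from located_eq_iff[OF assms(2) this] show ?thesis
    using edge_opp located_less[OF n] assms by (metis agent.select_convs(1))
qed

section \<open>Agents moving apart\<close>

text \<open>An agent in control state \<open>q\<close> with waiting time \<open>\<beta>\<close> keeps moving on side \<open>s\<close>. The bound
  on \<open>\<beta>\<close> keeps an agent in \<open>Init\<close> from bouncing in round \<open>2 * N - 4\<close>.\<close>

definition heads :: "'a \<Rightarrow> side \<Rightarrow> state \<Rightarrow> nat \<Rightarrow> int \<Rightarrow> bool" where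
  "heads a s q \<beta> g \<longleftrightarrow>
    q = Forward \<and> s = lft a \<or> q = Bounce \<and> s = opp (lft a) \<or>
    q = Init \<and> s = lft a \<and> int \<beta> \<le> g"

text \<open>The condition before Look that leads to \<open>heads\<close> after Compute. The last
  disjunct is an agent still in \<open>Init\<close> that is about to bounce.\<close>

definition headed :: "'a \<Rightarrow> side \<Rightarrow> nat \<Rightarrow> int \<Rightarrow> bool" where
  "headed a s t g \<longleftrightarrow>
    (let m = mem (C t a) in
     heads a s (ctrl m) (Btime m) g \<and> (ctrl m = Init \<longrightarrow> \<not> failed m) \<or>
     ctrl m = Init \<and> s = opp (lft a) \<and> (failed m \<or> t \<ge> 2 * N - 4 \<and> Btime m \<ge> N - 1))"

text \<open>On different nodes nobody catches or is caught, and a waiting time of at most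
  \<open>g\<close> stays below the threshold \<open>N - 1\<close>.\<close>

lemma headed_decision:
  assumes "a \<noteq> b" "headed a s t g" "g \<le> int n - 2" "t < 3 * N - 6"
    and "node (C t a) \<noteq> node (C t b)"
  obtains q where "dec t a = (q, Some (ori a s))" "heads a s q (Btime (mem (C t a))) g"
proof -
  have "g < int (N - 1)" using assms(3) n_ge N_ge by linarith
  then have "\<exists>q. dec t a = (q, Some (ori a s)) \<and> heads a s q (Btime (mem (C t a))) g"
    using assms(2,4,5) dec_Forward[of t a] dec_Bounce[of t a] dec_Init[OF assms(1), of t]
    unfolding headed_def heads_def Let_def by auto
  then show thesis using that by blast
qed

text \<open>\<open>w\<close> is the guaranteed gap. The gap itself also bounds the waiting time of
  an agent that goes left in \<open>Init\<close>. Above \<open>n - 2\<close> the ring is explored,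
  so smaller gaps suffice.\<close>

definition departing :: "side \<Rightarrow> 'a \<Rightarrow> 'a \<Rightarrow> nat \<Rightarrow> int \<Rightarrow> bool" where
  "departing s a b t w \<longleftrightarrow>
    explored_by n C t \<or>
    (\<exists>k l. located n s (C t a) k \<and> located n s (C t b) l \<and>
       w \<le> k - l \<and> 0 < k - l \<and> k - l \<le> int n - 2 \<and>
       (\<forall>i. l \<le> i \<longrightarrow> i \<le> k \<longrightarrow> visited s t i) \<and>
       headed a s t (k - l) \<and> headed b (opp s) t (k - l))"

text \<open>The waiting time grows by at most one per round, so a growing gap keeps bounding
  it.\<close>

lemma heads_headed:
  assumes "heads a s q \<beta> g" "C (Suc t) a = attempt n e c s' q" "Btime (mem c) = \<beta>" "g < g'"
  shows "headed a s (Suc t) g'"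
proof -
  have "Btime (mem (C (Suc t) a)) \<le> Suc \<beta>" "ctrl (mem (C (Suc t) a)) = q"
    "\<not> failed (mem (C (Suc t) a))"
    using assms(2,3) attempt_mem by metis+
  then show ?thesis using assms(1,4) unfolding headed_def heads_def Let_def by auto
qed

text \<open>As long as the gap \<open>k - l\<close> is below \<open>n - 1\<close>, the two agents try different edges, so that the
  adversary can block only one of them.\<close>

lemma depart_step:
  assumes "a \<noteq> b" and la: "located n s (C t a) k" and lb: "located n s (C t b) l"
    and "0 \<le> k - l" "k - l \<le> int n - 2"
    and vis: "\<And>i. l \<le> i \<Longrightarrow> i \<le> k \<Longrightarrow> visited s t i"
    and da: "dec t a = (qa, Some (ori a s))" "heads a s qa (Btime (mem (C t a))) (k - l)"
    and db: "dec t b = (qb, Some (ori b (opp s)))"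
      "heads b (opp s) qb (Btime (mem (C t b))) (k - l)"
    and free: "node (C t a) \<noteq> node (C t b) \<or>
      pos (C t a) \<noteq> Port (opp s) \<and> pos (C t b) \<noteq> Port s"
  shows "departing s a b (Suc t) (k - l + 1)"
proof -
  have n: "0 < n" using n_ge by simp
  obtain e where ea: "C (Suc t) a = attempt n e (C t a) s qa"
    and eb: "C (Suc t) b = attempt n e (C t b) (opp s) qb"
    using both_attempt[OF assms(1) da(1) db(1)] free by auto
  define k' where "k' = (if e = Some (edge n (node (C t a)) s) then k else k + 1)"
  define l' where "l' = (if e = Some (edge n (node (C t b)) (opp s)) then l else l - 1)"
  have la': "located n s (C (Suc t) a) k'"
    using located_attempt(1)[OF n la] by (simp add: ea k'_def)
  have lb': "located n s (C (Suc t) b) l'"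
    using located_attempt(2)[OF n lb] by (simp add: eb l'_def)
  \<comment> \<open>The gap plus one lies strictly between \<open>0\<close> and \<open>n\<close>, so
    the agents do not face each other across one edge.\<close>
  have "\<not> int n dvd k - l + 1"
    using assms(4,5) by (intro not_dvd_between) auto
  then have "\<not> int n dvd l - (k + 1)"
    by (metis dvd_minus_iff minus_diff_eq diff_diff_eq2 diff_add_eq add.commute)
  then have "k' - l' \<ge> k - l + 1"
    using facing_iff[OF la lb] by (auto simp: k'_def l'_def)
  have vis': "visited s (Suc t) i" if i: "l' \<le> i" "i \<le> k'" for i
  proof -
    consider "i = l'" | "i = k'" | "l \<le> i \<and> i \<le> k"
      using i by (force simp: k'_def l'_def split: if_splits)
    then show ?thesis
      using visitedI[OF la'] visitedI[OF lb'] vis visited_mono[of s t i "Suc t"] by cases auto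
  qed
  show ?thesis
  proof (cases "k' - l' \<le> int n - 2")
    case True
    have "headed a s (Suc t) (k' - l')"
      using heads_headed[OF da(2) ea refl] \<open>k' - l' \<ge> k - l + 1\<close> by simp
    moreover have "headed b (opp s) (Suc t) (k' - l')"
      using heads_headed[OF db(2) eb refl] \<open>k' - l' \<ge> k - l + 1\<close> by simp
    ultimately show ?thesis
      unfolding departing_def using la' lb' vis' True \<open>k' - l' \<ge> k - l + 1\<close> assms(4) by force
  next
    case False
    then have "explored_by n C (Suc t)"
      by (intro exploredI[of l' s]) (auto intro: vis')
    then show ?thesis by (simp add: departing_def)
  qed
qed

text \<open>The case of gap zero, kept separate because \<open>departing\<close> asks for a positive
  gap.\<close>

lemma departing_from_meeting:
  assumes "a \<noteq> b" and la: "located n s (C t a) k" and lb: "located n s (C t b) k"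
    and da: "dec t a = (qa, Some (ori a s))" "heads a s qa (Btime (mem (C t a))) 0"
    and db: "dec t b = (qb, Some (ori b (opp s)))" "heads b (opp s) qb (Btime (mem (C t b))) 0"
    and free: "pos (C t a) \<noteq> Port (opp s)" "pos (C t b) \<noteq> Port s"
  shows "departing s a b (Suc t) 1"
proof -
  have vis: "visited s t i" if "k \<le> i" "i \<le> k" for i
    using visitedI[OF la] that by (metis order_antisym)
  have "departing s a b (Suc t) (k - k + 1)"
    by (rule depart_step[OF assms(1) la lb _ _ vis da(1) _ db(1)]) (use da db free n_ge in simp_all)
  then show ?thesis by simp
qed

lemma departing_Suc:
  assumes "a \<noteq> b" "departing s a b t w" "t < 3 * N - 6"
  shows "departing s a b (Suc t) (w + 1)"
proof (cases "explored_by n C t")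
  case True
  then show ?thesis using explored_mono[of t "Suc t"] by (simp add: departing_def)
next
  case False
  then obtain k l where kl: "located n s (C t a) k" "located n s (C t b) l"
    "w \<le> k - l" "0 < k - l" "k - l \<le> int n - 2"
    "\<And>i. l \<le> i \<Longrightarrow> i \<le> k \<Longrightarrow> visited s t i"
    "headed a s t (k - l)" "headed b (opp s) t (k - l)"
    using assms(2) unfolding departing_def by blast
  have apart: "node (C t a) \<noteq> node (C t b)"
    using nodes_differ[OF kl(1,2)] kl(4,5) by simp
  obtain qa where "dec t a = (qa, Some (ori a s))" "heads a s qa (Btime (mem (C t a))) (k - l)"
    using headed_decision[OF assms(1) kl(7,5) assms(3) apart] .
  moreover obtain qb where "dec t b = (qb, Some (ori b (opp s)))"
    "heads b (opp s) qb (Btime (mem (C t b))) (k - l)"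
    using headed_decision[OF assms(1)[symmetric] kl(8,5) assms(3) apart[symmetric]] .
  ultimately have "departing s a b (Suc t) (k - l + 1)"
    using kl apart by (intro depart_step[OF assms(1)]) auto
  then show ?thesis using kl(3) unfolding departing_def by fastforce
qed

text \<open>The guaranteed gap grows by one per round, and \<open>(2 * N - 4) + (n - 2)\<close> is
  at most \<open>3 * N - 6\<close>.\<close>

lemma departing_explored:
  assumes "a \<noteq> b" "departing s a b t 1" "t \<le> 2 * N - 4"
  shows "explored_by n C (3 * N - 6)"
proof -
  have "departing s a b (t + j) (1 + int j)" if "j \<le> n - 2" for j
    using that
  proof (induction j)
    case 0
    then show ?case using assms(2) by simp
  next
    case (Suc j)
    then have "t + j < 3 * N - 6" using assms(3) n_ge N_ge by linarith
    with Suc departing_Suc[OF assms(1), of s "t + j" "1 + int j"] show ?case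
      by (simp add: add_ac)
  qed
  \<comment> \<open>The guaranteed gap is now \<open>n - 1\<close>, which leaves only the explored
    alternative.\<close>
  from this[of "n - 2"] have "explored_by n C (t + (n - 2))"
    using n_ge unfolding departing_def by auto
  then show ?thesis using assms(3) n_ge N_ge by (elim explored_mono) linarith
qed


section \<open>Opposite orientations\<close>

text \<open>The agents have started at \<open>p\<close> and \<open>r\<close> and are now at \<open>k < l\<close>. A round may pass without
  progress only if \<open>l = k + 1\<close>, so the rounds wasted since then are counted by \<open>Btime\<close>.\<close>

definition approaching :: "side \<Rightarrow> 'a \<Rightarrow> 'a \<Rightarrow> int \<Rightarrow> int \<Rightarrow> nat \<Rightarrow> bool" where
  "approaching s a b p r t \<longleftrightarrow>
    (\<forall>c. ctrl (mem (C t c)) = Init \<and> \<not> failed (mem (C t c))) \<and>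
    (\<exists>k l. located n s (C t a) k \<and> located n s (C t b) l \<and> p \<le> k \<and> k < l \<and> l \<le> r \<and>
       (\<forall>i. p \<le> i \<longrightarrow> i \<le> k \<longrightarrow> visited s t i) \<and> (\<forall>i. l \<le> i \<longrightarrow> i \<le> r \<longrightarrow> visited s t i) \<and>
       (if k + 1 < l then int t \<le> (k - p) + (r - l)
        else \<forall>c. int t \<le> r - p - 1 + int (Btime (mem (C t c)))))"

text \<open>At distance two or more the edges differ, so somebody moves, possibly both onto a common
  node. At distance one the agents try the same edge: both wait or they cross.\<close>

lemma approaching_Suc:
  assumes "a \<noteq> b" "lft a = s" "lft b = opp s" "r - p < int n" "t < 2 * N - 4"
    and "approaching s a b p r t"
  shows "approaching s a b p r (Suc t) \<or> (\<exists>t'\<le>2 * N - 4. departing s a b t' 1)"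
proof -
  have n: "0 < n" using n_ge by simp
  have oa: "ori a s = Left" using assms(2) ori_lft by metis
  have ob: "ori b (opp s) = Left" using assms(3) ori_lft by metis
  have time: "t < 3 * N - 6" using assms(5) n_ge N_ge by linarith
  obtain k l where la: "located n s (C t a) k" and lb: "located n s (C t b) l"
    and kl: "p \<le> k" "k < l" "l \<le> r"
    and va: "\<And>i. p \<le> i \<Longrightarrow> i \<le> k \<Longrightarrow> visited s t i"
    and vb: "\<And>i. l \<le> i \<Longrightarrow> i \<le> r \<Longrightarrow> visited s t i"
    and count: "if k + 1 < l then int t \<le> (k - p) + (r - l)
        else \<forall>c. int t \<le> r - p - 1 + int (Btime (mem (C t c)))"
    and ctrl: "\<And>c. ctrl (mem (C t c)) = Init" "\<And>c. \<not> failed (mem (C t c))"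
    using assms(6) unfolding approaching_def by blast
  have apart: "node (C t a) \<noteq> node (C t b)"
    using nodes_differ[OF la lb] kl assms(4) by simp
  have "dec t a = (Init, Some (ori a s))"
    using dec_Init[OF assms(1) ctrl(1) time] ctrl(2) apart assms(5) oa by simp
  moreover have "dec t b = (Init, Some (ori b (opp s)))"
    using dec_Init[OF assms(1)[symmetric] ctrl(1) time] ctrl(2) apart assms(5) ob by simp
  ultimately obtain e where ea: "C (Suc t) a = attempt n e (C t a) s Init"
    and eb: "C (Suc t) b = attempt n e (C t b) (opp s) Init"
    using both_attempt[OF assms(1)] apart by blast
  define k' where "k' = (if e = Some (edge n (node (C t a)) s) then k else k + 1)"
  define l' where "l' = (if e = Some (edge n (node (C t b)) (opp s)) then l else l - 1)"
  have la': "located n s (C (Suc t) a) k'"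
    using located_attempt(1)[OF n la] by (simp add: ea k'_def)
  have lb': "located n s (C (Suc t) b) l'"
    using located_attempt(2)[OF n lb] by (simp add: eb l'_def)
  have ctrl': "ctrl (mem (C (Suc t) c)) = Init" "\<not> failed (mem (C (Suc t) c))" for c
    using UNIV_agents[OF assms(1), of c] ea eb by auto
  have va': "visited s (Suc t) i" if i: "p \<le> i" "i \<le> k'" for i
  proof -
    have "i \<le> k \<or> i = k'" using i by (auto simp: k'_def split: if_splits)
    then show ?thesis
      using visitedI[OF la'] va i visited_mono[of s t i "Suc t"] by auto
  qed
  have vb': "visited s (Suc t) i" if i: "l' \<le> i" "i \<le> r" for i
  proof -
    have "l \<le> i \<or> i = l'" using i by (auto simp: l'_def split: if_splits)
    then show ?thesis
      using visitedI[OF lb'] vb i visited_mono[of s t i "Suc t"] by auto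
  qed
  have bounds: "p \<le> k'" "l' \<le> r" using kl by (auto simp: k'_def l'_def)
  show ?thesis
  proof (cases "k + 1 < l")
    case True
    then have "\<not> int n dvd l - (k + 1)"
      using kl assms(4) by (intro not_dvd_between) auto
    then have progress: "l' - k' \<le> l - k - 1"
      using facing_iff[OF la lb] by (auto simp: k'_def l'_def)
    have t_le: "int t \<le> (k - p) + (r - l)" using count True by simp
    show ?thesis
    proof (cases "k' < l'")
      case True
      \<comment> \<open>When the distance drops to one, \<open>(k' - p) + (r - l')\<close> is
        \<open>r - p - 1\<close>, and the count by \<open>Btime\<close> takes over.\<close>
      have "if k' + 1 < l' then int (Suc t) \<le> (k' - p) + (r - l')
        else \<forall>c. int (Suc t) \<le> r - p - 1 + int (Btime (mem (C (Suc t) c)))"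
        using progress t_le True by auto
      then have "approaching s a b p r (Suc t)"
        unfolding approaching_def using la' lb' ctrl' True va' vb' bounds by blast
      then show ?thesis ..
    next
      case False
      \<comment> \<open>They have met inside one node; one more round in \<open>Init\<close> sends
        them apart.\<close>
      then have eq: "k' = k + 1" "l' = l - 1" "l' = k'"
        using \<open>k + 1 < l\<close> by (auto simp: k'_def l'_def split: if_splits)
      then have moved: "e \<noteq> Some (edge n (node (C t a)) s)"
        "e \<noteq> Some (edge n (node (C t b)) (opp s))"
        by (auto simp: k'_def l'_def split: if_splits)
      have in': "pos (C (Suc t) a) = Inside" "pos (C (Suc t) b) = Inside"
        "Btime (mem (C (Suc t) a)) = 0" "Btime (mem (C (Suc t) b)) = 0"
        using moved ea eb by (simp_all add: attempt_moved)
      \<comment> \<open>Here \<open>l = k + 2\<close>, so \<open>t\<close> is at most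
        \<open>r - p - 2\<close> and thus at most \<open>n - 3\<close>.\<close>
      have late: "Suc (Suc t) \<le> 2 * N - 4" "Suc t < 3 * N - 6"
        using t_le eq assms(4) n_ge N_ge by linarith+
      have "dec (Suc t) a = (Init, Some (ori a s))"
        using dec_Init[OF assms(1) ctrl'(1) late(2)] ctrl'(2) in' late(1) oa by simp
      moreover have "dec (Suc t) b = (Init, Some (ori b (opp s)))"
        using dec_Init[OF assms(1)[symmetric] ctrl'(1) late(2)] ctrl'(2) in' late(1) ob by simp
      ultimately have "departing s a b (Suc (Suc t)) 1"
        using in' assms(2,3)
        by (intro departing_from_meeting[OF assms(1) la' lb'[unfolded eq(3)]])
          (auto simp: heads_def)
      then show ?thesis using late(1) by auto
    qed
  next
    case False
    then have l: "l = k + 1" using kl by simp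
    then have edges: "edge n (node (C t b)) (opp s) = edge n (node (C t a)) s"
      using facing_iff[OF la lb] by simp
    show ?thesis
    proof (cases "e = Some (edge n (node (C t a)) s)")
      case True
      then have "k' = k" "l' = l" using edges by (auto simp: k'_def l'_def)
      moreover have "int (Suc t) \<le> r - p - 1 + int (Btime (mem (C (Suc t) c)))" for c
      proof -
        have "Btime (mem (C (Suc t) c)) = Suc (Btime (mem (C t c)))"
          using UNIV_agents[OF assms(1), of c] ea eb edges True by (auto simp: attempt_blocked)
        then show ?thesis using count[unfolded if_not_P[OF False], rule_format, of c] by simp
      qed
      ultimately have "approaching s a b p r (Suc t)"
        unfolding approaching_def using la' lb' ctrl' l kl va' vb'
        by (intro conjI allI exI[of _ k] exI[of _ l]) auto
      then show ?thesis ..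
    next
      case False
      \<comment> \<open>They have crossed and are back to back at distance one, with waiting times
        reset.\<close>
      then have eq: "k' = k + 1" "l' = k" using edges l by (auto simp: k'_def l'_def)
      have "Btime (mem (C (Suc t) a)) = 0" "Btime (mem (C (Suc t) b)) = 0"
        using False edges ea eb by (simp_all add: attempt_moved)
      then have "headed a s (Suc t) 1" "headed b (opp s) (Suc t) 1"
        using ctrl' assms(2,3) by (simp_all add: headed_def heads_def Let_def)
      moreover have "visited s (Suc t) i" if i: "k \<le> i" "i \<le> k + 1" for i
      proof -
        have "i = k' \<or> i = l'" using i eq by auto
        then show ?thesis using visitedI[OF la'] visitedI[OF lb'] by blast
      qed
      ultimately have "departing s a b (Suc t) 1"
        unfolding departing_def using la' lb' n_ge unfolding eq
        by (intro disjI2 exI[of _ "k + 1"] exI[of _ k]) auto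
      then show ?thesis using assms(5) Suc_leI by blast
    qed
  qed
qed

text \<open>Unless all is explored, both agents bounce now, so \<open>b\<close> is the one to move
  on side \<open>s\<close>; hence the exchanged order.\<close>

lemma approaching_late:
  assumes "a \<noteq> b" "lft a = s" "lft b = opp s" "r - p < int n"
    and "approaching s a b p r (2 * N - 4)"
  shows "departing s b a (2 * N - 4) 1"
proof -
  let ?t = "2 * N - 4"
  obtain k l where la: "located n s (C ?t a) k" and lb: "located n s (C ?t b) l"
    and kl: "p \<le> k" "k < l" "l \<le> r"
    and va: "\<And>i. p \<le> i \<Longrightarrow> i \<le> k \<Longrightarrow> visited s ?t i"
    and vb: "\<And>i. l \<le> i \<Longrightarrow> i \<le> r \<Longrightarrow> visited s ?t i"
    and count: "if k + 1 < l then int ?t \<le> (k - p) + (r - l)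
        else \<forall>c. int ?t \<le> r - p - 1 + int (Btime (mem (C ?t c)))"
    and ctrl: "\<And>c. ctrl (mem (C ?t c)) = Init"
    using assms(5) unfolding approaching_def by blast
  \<comment> \<open>At a larger distance every round has made progress, which allows at most
    \<open>n - 3\<close> rounds.\<close>
  have "\<not> k + 1 < l"
  proof
    assume "k + 1 < l"
    then have "int ?t \<le> (k - p) + (r - l)" using count by simp
    then show False using assms(4) n_ge N_ge \<open>k + 1 < l\<close> by linarith
  qed
  then have l: "l = k + 1" and wait: "\<And>c. int ?t \<le> r - p - 1 + int (Btime (mem (C ?t c)))"
    using kl count by auto
  have vis: "visited s ?t i" if "p \<le> i" "i \<le> r" for i
    using va vb l that by (cases "i \<le> k") auto
  show ?thesis
  proof (cases "r - p = int n - 1")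
    case True
    have "explored_by n C ?t" by (rule exploredI[of p s]) (use vis True in auto)
    then show ?thesis by (simp add: departing_def)
  next
    case False
    \<comment> \<open>Now \<open>r - p\<close> is at most \<open>n - 2\<close>, and
      \<open>(2 * N - 4) - (n - 3)\<close> is at least \<open>N - 1\<close>, the threshold for
      bouncing.\<close>
    have "N - 1 \<le> Btime (mem (C ?t c))" for c
      using wait[of c] False assms(4) n_ge N_ge by linarith
    then have "headed b s ?t 1" "headed a (opp s) ?t 1"
      using ctrl assms(2,3) by (simp_all add: headed_def Let_def)
    then show ?thesis
      unfolding departing_def using la lb l n_ge vis kl
      by (intro disjI2 exI[of _ "k + 1"] exI[of _ k]) auto
  qed
qed

section \<open>Equal orientations\<close>

text \<open>\<open>b\<close> runs into \<open>a\<close>, which waits on a blocked port: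
  \<open>a\<close> is caught and goes forward, \<open>b\<close> catches and bounces. The clock tests
  do not fire yet.\<close>

lemma catch:
  assumes "a \<noteq> b" "lft a = s" "lft b = s" "t < 2 * N - 4"
    and la: "located n s (C t a) k" and lb: "located n s (C t b) k"
    and ctrl: "\<And>c. ctrl (mem (C t c)) = Init" "\<not> failed (mem (C t a))"
    and port: "pos (C t a) = Port s" "\<not> moved (mem (C t a))" "pos (C t b) = Inside"
  shows "departing s a b (Suc t) 1"
proof -
  have same: "node (C t a) = node (C t b)" using located_eq_iff[OF la lb] by simp
  have oa: "ori a s = Left" using assms(2) ori_lft by metis
  have ob: "ori b (opp s) = Right" using assms(3) ori_opp_lft by metis
  have time: "t < 3 * N - 6" using assms(4) n_ge N_ge by linarith
  have "dec t a = (Forward, Some (ori a s))"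
    using dec_Init[OF assms(1) ctrl(1) time] ctrl(2) port same assms(2,4) oa by simp
  moreover have "dec t b = (Bounce, Some (ori b (opp s)))"
    using dec_Init[OF assms(1)[symmetric] ctrl(1) time] port same assms(3,4) ob by simp
  ultimately show ?thesis
    using port assms(2,3)
    by (intro departing_from_meeting[OF assms(1) la lb]) (auto simp: heads_def)
qed

text \<open>The agents have started at \<open>p\<close> and \<open>r\<close> and are now at \<open>k\<close> and \<open>l\<close>.\<close>

definition chasing :: "side \<Rightarrow> 'a \<Rightarrow> 'a \<Rightarrow> int \<Rightarrow> int \<Rightarrow> nat \<Rightarrow> bool" where
  "chasing s a b p r t \<longleftrightarrow>
    (\<forall>c. ctrl (mem (C t c)) = Init \<and> \<not> failed (mem (C t c))) \<and>
    (\<exists>k l. located n s (C t a) k \<and> located n s (C t b) l \<and> p \<le> k \<and> r \<le> l \<and>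
       k < l \<and> l < k + int n \<and>
       (\<forall>i. p \<le> i \<longrightarrow> i \<le> k \<longrightarrow> visited s t i) \<and> (\<forall>i. r \<le> i \<longrightarrow> i \<le> l \<longrightarrow> visited s t i) \<and>
       int t \<le> (k - p) + (l - r))"

text \<open>As \<open>l\<close> lies between \<open>k\<close> and \<open>k + n\<close>, a large
  total forces both visited ranges to be long, and together they cover a full turn.\<close>

lemma chase_explored:
  assumes "p < r" "r < p + int n" "p \<le> k" "r \<le> l" "k \<le> l" "l \<le> k + int n"
    and "\<And>i. p \<le> i \<Longrightarrow> i \<le> k \<Longrightarrow> visited s t i" "\<And>i. r \<le> i \<Longrightarrow> i \<le> l \<Longrightarrow> visited s t i"
    and "2 * int n - 4 \<le> (k - p) + (l - r)"
  shows "explored_by n C t"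
proof (rule exploredI[of p s])
  fix i assume "p \<le> i" "i \<le> p + int n - 1"
  \<comment> \<open>The sum yields \<open>2 * k \<ge> 2 * r - 3\<close> and
    \<open>2 * l \<ge> 2 * (p + n) - 3\<close>; integrality rounds both up to the claim, so
    \<open>2 * n - 4\<close> just suffices.\<close>
  moreover have "r - 1 \<le> k" "p + int n - 1 \<le> l" using assms(1-6,9) by linarith+
  ultimately show "visited s t i" using assms(7,8)[of i] by (cases "i \<le> k") auto
qed

text \<open>From different nodes the same side means different edges, so at least one agent
  advances. The chase ends when \<open>a\<close> reaches \<open>b\<close>, or \<open>b\<close> comes
  round and reaches \<open>a\<close>.\<close>

lemma chasing_Suc:
  assumes "a \<noteq> b" "lft a = s" "lft b = s" "p < r" "r < p + int n" "t < 2 * N - 4"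
    and "chasing s a b p r t"
  shows "chasing s a b p r (Suc t) \<or>
    (\<exists>t'\<le>2 * N - 4. departing s a b t' 1 \<or> departing s b a t' 1)"
proof -
  have n: "0 < n" using n_ge by simp
  have oa: "ori a s = Left" using assms(2) ori_lft by metis
  have ob: "ori b s = Left" using assms(3) ori_lft by metis
  have time: "t < 3 * N - 6" using assms(6) n_ge N_ge by linarith
  obtain k l where la: "located n s (C t a) k" and lb: "located n s (C t b) l"
    and kl: "p \<le> k" "r \<le> l" "k < l" "l < k + int n"
    and va: "\<And>i. p \<le> i \<Longrightarrow> i \<le> k \<Longrightarrow> visited s t i"
    and vb: "\<And>i. r \<le> i \<Longrightarrow> i \<le> l \<Longrightarrow> visited s t i"
    and count: "int t \<le> (k - p) + (l - r)"
    and ctrl: "\<And>c. ctrl (mem (C t c)) = Init" "\<And>c. \<not> failed (mem (C t c))"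
    using assms(7) unfolding chasing_def by blast
  have apart: "node (C t a) \<noteq> node (C t b)"
    using nodes_differ[OF la lb] kl by simp
  have "dec t a = (Init, Some (ori a s))"
    using dec_Init[OF assms(1) ctrl(1) time] ctrl(2) apart assms(6) oa by simp
  moreover have "dec t b = (Init, Some (ori b s))"
    using dec_Init[OF assms(1)[symmetric] ctrl(1) time] ctrl(2) apart assms(6) ob by simp
  ultimately obtain e where ea: "C (Suc t) a = attempt n e (C t a) s Init"
    and eb: "C (Suc t) b = attempt n e (C t b) s Init"
    using both_attempt[OF assms(1)] apart by blast
  have "edge n (node (C t a)) s \<noteq> edge n (node (C t b)) s"
    using edge_same located_less[OF n la] located_less[OF n lb] apart by blast
  then have one: "e \<noteq> Some (edge n (node (C t a)) s) \<or> e \<noteq> Some (edge n (node (C t b)) s)"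
    by auto
  define k' where "k' = (if e = Some (edge n (node (C t a)) s) then k else k + 1)"
  define l' where "l' = (if e = Some (edge n (node (C t b)) s) then l else l + 1)"
  have la': "located n s (C (Suc t) a) k'"
    using located_attempt(1)[OF n la] by (simp add: ea k'_def)
  have lb': "located n s (C (Suc t) b) l'"
    using located_attempt(1)[OF n lb] by (simp add: eb l'_def)
  have ctrl': "ctrl (mem (C (Suc t) c)) = Init" "\<not> failed (mem (C (Suc t) c))" for c
    using UNIV_agents[OF assms(1), of c] ea eb by auto
  have va': "visited s (Suc t) i" if i: "p \<le> i" "i \<le> k'" for i
  proof -
    have "i \<le> k \<or> i = k'" using i by (auto simp: k'_def split: if_splits)
    then show ?thesis
      using visitedI[OF la'] va i visited_mono[of s t i "Suc t"] by auto
  qed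
  have vb': "visited s (Suc t) i" if i: "r \<le> i" "i \<le> l'" for i
  proof -
    have "i \<le> l \<or> i = l'" using i by (auto simp: l'_def split: if_splits)
    then show ?thesis
      using visitedI[OF lb'] vb i visited_mono[of s t i "Suc t"] by auto
  qed
  have bounds: "p \<le> k'" "r \<le> l'" "k' \<le> l'" "l' \<le> k' + int n"
    using kl by (auto simp: k'_def l'_def)
  have count': "int (Suc t) \<le> (k' - p) + (l' - r)"
    using count one by (auto simp: k'_def l'_def)
  \<comment> \<open>A meeting at time \<open>2 * N - 4\<close> is too late for \<open>catch\<close>,
    but by then the number of steps alone gives exploration.\<close>
  have last: "explored_by n C (Suc t)" if "Suc t = 2 * N - 4"
    using chase_explored[OF assms(4,5) bounds va' vb'] count' that n_ge N_ge by linarith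
  consider "k' < l'" "l' < k' + int n" | "k' = l'" | "l' = k' + int n"
    using bounds by linarith
  then show ?thesis
  proof cases
    case 1
    then have "chasing s a b p r (Suc t)"
      unfolding chasing_def using la' lb' ctrl' va' vb' bounds count' by blast
    then show ?thesis ..
  next
    case 2
    \<comment> \<open>They can coincide only if \<open>a\<close> moved while \<open>b\<close> was
      blocked, so \<open>b\<close> is on its port and \<open>a\<close> inside.\<close>
    then have "l' = l" "k' = k + 1" using kl by (auto simp: k'_def l'_def split: if_splits)
    then have "e = Some (edge n (node (C t b)) s)" "e \<noteq> Some (edge n (node (C t a)) s)"
      by (auto simp: k'_def l'_def split: if_splits)
    then have "pos (C (Suc t) b) = Port s" "\<not> moved (mem (C (Suc t) b))"
      "pos (C (Suc t) a) = Inside"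
      using ea eb by (simp_all add: attempt_blocked attempt_moved)
    then have early: "departing s b a (Suc (Suc t)) 1" if "Suc t < 2 * N - 4"
      using catch[OF assms(1)[symmetric] assms(3,2) that lb' la'[unfolded 2] ctrl'] by simp
    show ?thesis
    proof (cases "Suc t = 2 * N - 4")
      case True
      then have "departing s a b (Suc t) 1" using last by (simp add: departing_def)
      then show ?thesis using True by auto
    next
      case False
      then have "Suc (Suc t) \<le> 2 * N - 4" using assms(6) by simp
      then show ?thesis using early False assms(6) by auto
    qed
  next
    case 3
    then have "l' = l + 1" "k' = k" using kl by (auto simp: k'_def l'_def split: if_splits)
    then have "e = Some (edge n (node (C t a)) s)" "e \<noteq> Some (edge n (node (C t b)) s)"
      by (auto simp: k'_def l'_def split: if_splits)
    then have "pos (C (Suc t) a) = Port s" "\<not> moved (mem (C (Suc t) a))"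
      "pos (C (Suc t) b) = Inside"
      using ea eb by (simp_all add: attempt_blocked attempt_moved)
    \<comment> \<open>\<open>b\<close> is a full turn ahead; dropping \<open>n\<close> gives both
      agents the same coordinate.\<close>
    moreover have "located n s (C (Suc t) b) k'" using lb' 3 by (simp add: located_shift)
    ultimately have early: "departing s a b (Suc (Suc t)) 1" if "Suc t < 2 * N - 4"
      using catch[OF assms(1-3) that la' _ ctrl'] by simp
    show ?thesis
    proof (cases "Suc t = 2 * N - 4")
      case True
      then have "departing s a b (Suc t) 1" using last by (simp add: departing_def)
      then show ?thesis using True by auto
    next
      case False
      then have "Suc (Suc t) \<le> 2 * N - 4" using assms(6) by simp
      then show ?thesis using early False assms(6) by auto
    qed
  qed
qed

lemma chasing_late:
  assumes "p < r" "r < p + int n" "chasing s a b p r (2 * N - 4)"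
  shows "explored_by n C (2 * N - 4)"
proof -
  have "2 * int n - 4 \<le> int (2 * N - 4)" using n_ge N_ge by linarith
  moreover obtain k l where "p \<le> k" "r \<le> l" "k < l" "l < k + int n"
    and "\<And>i. p \<le> i \<Longrightarrow> i \<le> k \<Longrightarrow> visited s (2 * N - 4) i"
    and "\<And>i. r \<le> i \<Longrightarrow> i \<le> l \<Longrightarrow> visited s (2 * N - 4) i"
    and "int (2 * N - 4) \<le> (k - p) + (l - r)"
    using assms(3) unfolding chasing_def by blast
  ultimately show ?thesis
    by (intro chase_explored[OF assms(1,2), of k l s]) simp_all
qed

text \<open>From a common node with equal orientations, exactly one agent \<open>a\<close> gains the contested port,
  and \<open>b\<close> bounces.\<close>

lemma contest_won:
  assumes "a \<noteq> b" "lft a = s" "lft b = s"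
    and la: "located n s (C 0 a) k" and lb: "located n s (C 0 b) k"
    and da: "dec 0 a = (Init, Some (ori a s))" and db: "dec 0 b = (Init, Some (ori b s))"
    and step: "\<And>c. C (Suc 0) c = next_agent n (KnownNNoChirality N) ori e G (C 0) c"
    and "a \<in> G" "b \<notin> G"
  shows "\<exists>t\<le>2 * N - 4. departing s a b t 1"
proof -
  have n: "0 < n" using n_ge by simp
  have late: "Suc (Suc 0) \<le> 2 * N - 4" "Suc 0 < 3 * N - 6" "Suc 0 < 2 * N - 4"
    using n_ge N_ge by linarith+
  have oa: "ori a s = Left" using assms(2) ori_lft by metis
  have ob: "ori b (opp s) = Right" using assms(3) ori_opp_lft by metis
  have ea: "C (Suc 0) a = attempt n e (C 0 a) s Init"
    using step next_attempt[OF da] assms(9) by simp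
  have eb: "node (C (Suc 0) b) = node (C 0 b)" "pos (C (Suc 0) b) = Inside"
    "ctrl (mem (C (Suc 0) b)) = Init" "failed (mem (C (Suc 0) b))"
    using step[of b] db assms(10) initial[of b] by (simp_all add: next_agent_def Let_def)
  have lb': "located n s (C (Suc 0) b) k" using lb eb(1) by (simp add: located_def)
  show ?thesis
  proof (cases "e = Some (edge n (node (C 0 a)) s)")
    case True
    \<comment> \<open>The winner is blocked: with \<open>b\<close> inside the node it is caught and
      goes forward, while \<open>failed\<close> makes \<open>b\<close> bounce.\<close>
    have la': "located n s (C (Suc 0) a) k"
      using located_attempt(1)[OF n la, where e = e and q = Init] True ea by simp
    have same: "node (C (Suc 0) a) = node (C (Suc 0) b)" using located_eq_iff[OF la' lb'] by simp
    have port: "pos (C (Suc 0) a) = Port s" "\<not> moved (mem (C (Suc 0) a))"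
      "ctrl (mem (C (Suc 0) a)) = Init" "\<not> failed (mem (C (Suc 0) a))"
      using ea True by (simp_all add: attempt_blocked)
    have "dec (Suc 0) a = (Forward, Some (ori a s))"
      using dec_Init[OF assms(1) port(3) late(2)] port same eb late(3) oa by simp
    moreover have "dec (Suc 0) b = (Bounce, Some (ori b (opp s)))"
      using dec_Init[OF assms(1)[symmetric] eb(3) late(2)] eb(4) ob by simp
    ultimately have "departing s a b (Suc (Suc 0)) 1"
      using port eb assms(2,3)
      by (intro departing_from_meeting[OF assms(1) la' lb']) (auto simp: heads_def)
    then show ?thesis using late(1) by blast
  next
    case False
    \<comment> \<open>The winner has left, so the gap is already one; \<open>failed\<close> is what
      makes \<open>b\<close> headed the other way.\<close>
    have la': "located n s (C (Suc 0) a) (k + 1)"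
      using located_attempt(1)[OF n la, where e = e and q = Init] False ea by simp
    have "headed a s (Suc 0) 1" "headed b (opp s) (Suc 0) 1"
      using ea eb False assms(2,3) by (simp_all add: headed_def heads_def Let_def attempt_moved)
    moreover have "visited s (Suc 0) i" if i: "k \<le> i" "i \<le> k + 1" for i
    proof -
      have "i = k \<or> i = k + 1" using i by auto
      then show ?thesis using visitedI[OF la'] visitedI[OF lb'] by blast
    qed
    ultimately have "departing s a b (Suc 0) 1"
      unfolding departing_def using la' lb' n_ge
      by (intro disjI2 exI[of _ "k + 1"] exI[of _ k]) auto
    then show ?thesis using late(3) less_imp_le by blast
  qed
qed

section \<open>Departure or exploration from every start\<close>

lemma initial_decision:
  assumes "lft a = s"
  shows "dec 0 a = (Init, Some (ori a s))"
proof -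
  obtain b where b: "a \<noteq> b"
    using card_agents by (metis card_2_iff)
  have late: "0 < 3 * N - 6" "0 < 2 * N - 4" using n_ge N_ge by linarith+
  have "ori a s = Left" using assms ori_lft by metis
  then show ?thesis
    using dec_Init[OF b initial(3) late(1)] initial late(2) by simp
qed

lemma common_start_departs:
  assumes "a \<noteq> b" "lft a = s"
    and la: "located n s (C 0 a) k" and lb: "located n s (C 0 b) k"
  shows "\<exists>t\<le>2 * N - 4. departing s a b t 1 \<or> departing s b a t 1"
proof (cases "lft b = s")
  case True
  note da = initial_decision[OF assms(2)] and db = initial_decision[OF True]
  have same: "node (C 0 a) = node (C 0 b)" using located_eq_iff[OF la lb] by simp
  obtain e G where G: "mutual_exclusion (KnownNNoChirality N) ori (C 0) G"
    and step: "\<And>c. C (Suc 0) c = next_agent n (KnownNNoChirality N) ori e G (C 0) c"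
    using one_round[of 0] by blast
  let ?K = "contenders (KnownNNoChirality N) ori (C 0) (node (C 0 a)) s"
  \<comment> \<open>Both agents contend for this free port, so exactly one gains it.\<close>
  have "c \<in> ?K" for c
    using UNIV_agents[OF assms(1), of c] da db same initial(2) by (auto simp: contenders_def)
  then have "?K = UNIV" by blast
  moreover have "\<not> occupied (C 0) (node (C 0 a)) s"
    by (simp add: occupied_def initial(2))
  ultimately have "\<exists>!c. c \<in> UNIV \<inter> G"
    using G unfolding mutual_exclusion_def by (metis UNIV_not_empty)
  then consider "a \<in> G" "b \<notin> G" | "b \<in> G" "a \<notin> G"
    using UNIV_agents[OF assms(1)] assms(1) by (metis Int_iff UNIV_I)
  then show ?thesis
  proof cases
    case 1
    then show ?thesis
      using contest_won[OF assms(1,2) True la lb da db step] by blast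
  next
    case 2
    then show ?thesis
      using contest_won[OF assms(1)[symmetric] True assms(2) lb la db da step] by blast
  qed
next
  case False
  then have b: "lft b = opp s" by (simp add: neq_opp_iff)
  have "departing s a b (Suc 0) 1"
    using initial_decision[OF assms(2)] initial_decision[OF b] assms(2) b initial
    by (intro departing_from_meeting[OF assms(1) la lb]) (auto simp: heads_def)
  moreover have "Suc 0 \<le> 2 * N - 4" using n_ge N_ge by linarith
  ultimately show ?thesis by blast
qed

lemma approaching_departs:
  assumes "a \<noteq> b" "lft a = s" "lft b = opp s" "r - p < int n" "approaching s a b p r 0"
  shows "\<exists>t\<le>2 * N - 4. departing s a b t 1 \<or> departing s b a t 1"
proof -
  have "approaching s a b p r t \<or> (\<exists>t'\<le>2 * N - 4. departing s a b t' 1)" if "t \<le> 2 * N - 4" for t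
    using that
  proof (induction t)
    case (Suc t)
    then show ?case using approaching_Suc[OF assms(1-4), of t] by auto
  qed (simp add: assms(5))
  then show ?thesis using approaching_late[OF assms(1-4)] by blast
qed

lemma chasing_departs:
  assumes "a \<noteq> b" "lft a = s" "lft b = s" "p < r" "r < p + int n" "chasing s a b p r 0"
  shows "\<exists>t\<le>2 * N - 4. departing s a b t 1 \<or> departing s b a t 1"
proof -
  have "chasing s a b p r t \<or>
      (\<exists>t'\<le>2 * N - 4. departing s a b t' 1 \<or> departing s b a t' 1)" if "t \<le> 2 * N - 4" for t
    using that
  proof (induction t)
    case (Suc t)
    then show ?case using chasing_Suc[OF assms(1-5), of t] by auto
  qed (simp add: assms(6))
  then show ?thesis
    using chasing_late[OF assms(4,5)] unfolding departing_def by blast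
qed

lemma explored_late: "explored_by n C (3 * N - 6)"
proof -
  have n: "0 < n" using n_ge by simp
  obtain a b :: 'a where ab: "a \<noteq> b"
    using card_agents by (metis card_2_iff)
  \<comment> \<open>Unrolling along the left side of \<open>a\<close> makes its coordinate increase
    while it goes left.\<close>
  define s where "s = lft a"
  obtain p where la: "located n s (C 0 a) p"
    using located_exists[OF initial(1)] by blast
  obtain q where lq: "located n s (C 0 b) q"
    using located_exists[OF initial(1)] by blast
  \<comment> \<open>This puts \<open>b\<close> less than one turn ahead of \<open>a\<close>;
    \<open>d = 0\<close> is a common start.\<close>
  define d where "d = (q - p) mod int n"
  have d: "0 \<le> d" "d < int n" using n by (simp_all add: d_def)
  have lb: "located n s (C 0 b) (p + d)"
  proof -
    have "(p + d) mod int n = q mod int n" by (simp add: d_def mod_add_right_eq)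
    then show ?thesis using lq unfolding located_def by (metis mod_mult_right_eq)
  qed
  have start: "visited s 0 i" if "i = p \<or> i = p + d" for i
    using that visitedI[OF la] visitedI[OF lb] by blast
  have init: "ctrl (mem (C 0 c)) = Init \<and> \<not> failed (mem (C 0 c))" for c
    using initial by simp
  have "\<exists>t\<le>2 * N - 4. departing s a b t 1 \<or> departing s b a t 1"
  proof (cases "d = 0")
    case True
    then show ?thesis using common_start_departs[OF ab s_def[symmetric] la] lb by simp
  next
    case False
    show ?thesis
    proof (cases "lft b = s")
      case True
      have "chasing s a b p (p + d) 0"
        unfolding chasing_def using la lb init d False start
        by (intro conjI allI exI[of _ p] exI[of _ "p + d"]) auto
      then show ?thesis
        using chasing_departs[OF ab s_def[symmetric] True, of p "p + d"] d False by simp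
    next
      case opposite: False
      have "approaching s a b p (p + d) 0"
        unfolding approaching_def using la lb init d False start
        by (intro conjI allI exI[of _ p] exI[of _ "p + d"]) auto
      then show ?thesis
        using approaching_departs[OF ab s_def[symmetric], of "p + d" p] opposite d
        by (simp add: neq_opp_iff)
    qed
  qed
  then show ?thesis using departing_explored ab by metis
qed

end

theorem theorem3:
  fixes n N :: nat
    and ori :: "'a::finite \<Rightarrow> orientation"
    and C :: "nat \<Rightarrow> 'a \<Rightarrow> state agent"
  assumes "n \<ge> 3" and "N \<ge> n"
    and "card (UNIV :: 'a set) = 2"
    and "\<And>a. bij (ori a)"
    and "execution n (KnownNNoChirality N) Init ori C"
  shows "explores_and_terminates_by n (KnownNNoChirality N) Terminate ori C (3 * N - 6)"
proof -
  interpret two_agents n N ori C by unfold_locales (fact assms)+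
  \<comment> \<open>Being terminal is the same as having reached time \<open>3 * N - 6\<close>, so
    only exploration by then and \<open>halted\<close> remain.\<close>
  show ?thesis
    unfolding explores_and_terminates_by_def terminal_at_iff
  proof (intro conjI allI impI)
    show "explored_by n C (3 * N - 6)" by (rule explored_late)
    show "\<exists>t\<le>3 * N - 6. 3 * N - 6 \<le> t" by (intro exI[of _ "3 * N - 6"]) simp
  next
    fix t assume "3 * N - 6 \<le> t"
    then show "explored_by n C t" by (rule explored_mono[OF explored_late])
  next
    fix a t t' assume "3 * N - 6 \<le> t" "t \<le> t'"
    then show "3 * N - 6 \<le> t'" "node (C t' a) = node (C t a)" "pos (C t' a) = pos (C t a)"
      using halted[of t t' a] by simp_all
  qed
qed

end
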